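(* Let $F$ be a regular distribution supported on $[0,1]$ with smooth PDF, and let $\epsilon>0$. Suppose we have access to a perturbed oracle $F^*$ which, when queried at $x$, returns $F^*(x)=F(x+\epsilon_1)+\epsilon_2$ for some unknown $\epsilon_1\in[-\epsilon^2/2,\epsilon^2/2]$ and $\epsilon_2\in[-\epsilon,\epsilon]$ (which may differ from query to query). Then $\tilde{O}(\epsilon^{-1/2})$ queries to $F^*$ suffice to learn $F$ within Lévy distance $O(\epsilon)$.
   Context: A distribution is smooth if it has no point masses and its PDF $f$ is $C^1$; it is regular iff $f'(v)(1-F(v))\ge-2f(v)^2$ for all $v$ (equivalently $qF^{-1}(1-q)$ concave). Learning within Lévy distance $\eta$ means outputting $\hat F$ with $\mathrm{L\acute{e}vy}(F,\hat F)\le\eta$, where $\mathrm{L\acute{e}vy}(F,G)=\inf\{\epsilon: F(v-\epsilon)-\epsilon\le G(v)\le F(v+\epsilon)+\epsilon\ \forall v\}$. $\tilde{O}$ hides polylog$(1/\epsilon)$ factors. *)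

theory Defs
  imports "HOL-Analysis.Analysis"
begin

text \<open>A distribution on the reals is represented by its CDF F.
  It is smooth, regular and supported on [0,1] if it has a density f on [0,1]
  which is C^1 on [0,1] (one-sided derivatives at the endpoints), F is the
  integral of f, and the regularity inequality holds on the support.\<close>

definition smooth_regular_01 :: "(real \<Rightarrow> real) \<Rightarrow> bool" where
  "smooth_regular_01 F \<longleftrightarrow>
     (\<exists>f f'.
        (\<forall>x\<in>{0..1}. 0 \<le> f x) \<and>
        (f has_integral 1) {0..1} \<and>
        (\<forall>x. F x = integral ({0..1} \<inter> {..x}) f) \<and>
        (\<forall>x\<in>{0..1}. (f has_real_derivative f' x) (at x within {0..1})) \<and>
        continuous_on {0..1} f' \<and>
        (\<forall>v\<in>{0..1}. f' v * (1 - F v) \<ge> - 2 * (f v)\<^sup>2))"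

definition levy_set :: "(real \<Rightarrow> real) \<Rightarrow> (real \<Rightarrow> real) \<Rightarrow> real set" where
  "levy_set F G = {e. 0 \<le> e \<and> (\<forall>v. F (v - e) - e \<le> G v \<and> G v \<le> F (v + e) + e)}"

definition levy_dist :: "(real \<Rightarrow> real) \<Rightarrow> (real \<Rightarrow> real) \<Rightarrow> real" where
  "levy_dist F G = Inf (levy_set F G)"

definition valid_answer :: "(real \<Rightarrow> real) \<Rightarrow> real \<Rightarrow> real \<Rightarrow> real \<Rightarrow> bool" where
  "valid_answer F \<epsilon> x y \<longleftrightarrow>
     (\<exists>e1 e2. \<bar>e1\<bar> \<le> \<epsilon>\<^sup>2 / 2 \<and> \<bar>e2\<bar> \<le> \<epsilon> \<and> y = F (x + e1) + e2)"

text \<open>Adaptive (deterministic) query algorithms as decision trees: either output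
  an estimate of the CDF, or query a point and continue depending on the answer.\<close>

datatype qalg = Output "real \<Rightarrow> real" | Query real "real \<Rightarrow> qalg"

text \<open>learns F eps d n A: against every adaptive adversary answering each query
  validly, A makes at most n queries and outputs G with Levy(F,G) \<le> d.\<close>

inductive learns :: "(real \<Rightarrow> real) \<Rightarrow> real \<Rightarrow> real \<Rightarrow> nat \<Rightarrow> qalg \<Rightarrow> bool"
  for F :: "real \<Rightarrow> real" and \<epsilon> :: real and d :: real where
  out: "levy_set F G \<noteq> {} \<Longrightarrow> levy_dist F G \<le> d \<Longrightarrow> learns F \<epsilon> d n (Output G)"
| qry: "(\<And>y. valid_answer F \<epsilon> x y \<Longrightarrow> learns F \<epsilon> d n (k y))
        \<Longrightarrow> learns F \<epsilon> d (Suc n) (Query x k)"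

end

theory Submission
  imports Defs
begin

text \<open>Regularity says that \<open>h = 1 / (1 - F)\<close> is convex. Bisect \<open>[0, 1]\<close> into dyadic intervals, sample
  each interval near its endpoints and its midpoint, and split it further only if its width \<open>w\<close>
  exceeds \<open>\<epsilon>\<close>, \<open>1 - F\<close> is at least of order \<open>\<epsilon>\<close> there, and either the drop \<open>d\<close> of \<open>1 - F\<close> satisfies
  \<open>d\<^sup>2 > 4 \<epsilon> (1 - F)\<close> or the midpoint value of \<open>1 - F\<close> is well above the average of the endpoint
  values. If the drop is small, convexity of \<open>h\<close> makes \<open>1 - F\<close> concave up to an error
  \<open>O(\<epsilon>)\<close>, so on an interval that is not split linear interpolation has error \<open>O(\<epsilon>)\<close>.

  The number of splits per level is \<open>O((1 + ln (1/\<epsilon>)) / sqrt \<epsilon>)\<close>, because each of them raises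
  one of three bounded monotone potentials: a large drop lowers \<open>sqrt (1 - F)\<close> by
  \<open>sqrt \<epsilon> / 2\<close>; otherwise either \<open>x + F x\<close> grows by \<open>sqrt \<epsilon>\<close>, or the bent midpoint forces
  \<open>1 +\<close> the chord slope of \<open>h\<close> to grow by a factor \<open>1 + sqrt \<epsilon>\<close>, and this slope is
  polynomial in \<open>1/\<epsilon>\<close>. There are \<open>O(1 + ln (1/\<epsilon>))\<close> levels.\<close>

section \<open>Regularity as convexity of \<open>1 / (1 - F)\<close>\<close>

text \<open>A density-free interface: convexity enters only through chord slopes over
  non-overlapping intervals, as far as \<open>F\<close> stays below 1.\<close>

locale regular_cdf =
  fixes F :: "real \<Rightarrow> real"
  assumes below: "x \<le> 0 \<Longrightarrow> F x = 0"
    and above: "1 \<le> x \<Longrightarrow> F x = 1"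
    and mono_F: "mono F"
    and chord_slopes_mono:
      "\<lbrakk>0 \<le> x; x < y; y \<le> u; u < v; v \<le> 1; F v < 1\<rbrakk> \<Longrightarrow>
        (1 / (1 - F y) - 1 / (1 - F x)) / (y - x) \<le> (1 / (1 - F v) - 1 / (1 - F u)) / (v - u)"

text \<open>The derivative \<open>f / (1 - F)^2\<close> of \<open>1 / (1 - F)\<close> has itself the
  derivative \<open>(f' * (1 - F) + 2 * f^2) / (1 - F)^3\<close>, which is nonnegative by
  regularity. The mean value theorem turns each chord slope into a value of this increasing
  function.\<close>

lemma smooth_regular_01_imp_regular_cdf:
  assumes "smooth_regular_01 F"
  shows "regular_cdf F"
proof -
  obtain f f' where nn: "\<And>x. x \<in> {0..1} \<Longrightarrow> 0 \<le> f x"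
    and int1: "(f has_integral 1) {0..1}"
    and F: "\<And>x. F x = integral ({0..1} \<inter> {..x}) f"
    and f': "\<And>x. x \<in> {0..1} \<Longrightarrow> (f has_real_derivative f' x) (at x within {0..1})"
    and reg: "\<And>v. v \<in> {0..1} \<Longrightarrow> f' v * (1 - F v) \<ge> - 2 * (f v)\<^sup>2"
    using assms unfolding smooth_regular_01_def by metis
  have cf: "continuous_on {0..1} f"
    using f' by (meson DERIV_continuous continuous_on_eq_continuous_within)
  have F_in: "F x = integral {0..x} f" if "x \<in> {0..1}" for x
  proof -
    have "{0..1} \<inter> {..x} = {0..x}" using that by auto
    thus ?thesis by (simp only: F)
  qed
  have F0: "F x = 0" if "x \<le> 0" for x
  proof -
    have "{0..1} \<inter> {..x} \<subseteq> {0}" using that by auto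
    hence "{0..1} \<inter> {..x} = {} \<or> {0..1} \<inter> {..x} = {0}" by blast
    thus ?thesis by (auto simp: F)
  qed
  have F1: "F x = 1" if "1 \<le> x" for x
  proof -
    have "{0..1} \<inter> {..x} = {0..1}" using that by auto
    thus ?thesis using int1 by (simp add: F integral_unique)
  qed
  have dF: "(F has_real_derivative f x) (at x within {0..1})" if "x \<in> {0..1}" for x
    using integral_has_real_derivative[OF cf that]
    by (rule has_field_derivative_transform_within[where d=1]) (use that F_in in auto)
  have at: "at x within {0..1} = at x" if "0 < x" "x < 1" for x :: real
    using that by (intro at_within_interior) auto
  have cF: "continuous_on {0..1} F"
    using dF by (meson DERIV_continuous continuous_on_eq_continuous_within)
  have mono01: "F x \<le> F y" if "0 \<le> x" "x \<le> y" "y \<le> 1" for x y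
  proof (rule DERIV_nonneg_imp_increasing_open[OF that(2)])
    show "\<exists>d. (F has_real_derivative d) (at t) \<and> 0 \<le> d" if "x < t" "t < y" for t
      using dF[of t] at[of t] nn[of t] that \<open>0 \<le> x\<close> \<open>y \<le> 1\<close> by auto
    show "continuous_on {x..y} F"
      by (rule continuous_on_subset[OF cF]) (use that in auto)
  qed
  have "mono F"
  proof
    fix x y :: real assume xy: "x \<le> y"
    have clamp: "F t = F (max 0 (min 1 t))" for t
      using F0[of t] F0[of 0] F1[of t] F1[of 1] by (cases "t \<le> 0"; cases "1 \<le> t"; simp)
    show "F x \<le> F y"
      by (subst (1 2) clamp, rule mono01) (use xy in auto)
  qed
  moreover have "(1 / (1 - F y) - 1 / (1 - F x)) / (y - x) \<le> (1 / (1 - F v) - 1 / (1 - F u)) / (v - u)"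
    if o: "0 \<le> x" "x < y" "y \<le> u" "u < v" "v \<le> 1" "F v < 1" for x y u v
  proof -
    define g where "g t = 1 / (1 - F t)" for t
    define g' where "g' t = f t / (1 - F t)\<^sup>2" for t
    have lt1: "F t < 1" if "0 \<le> t" "t \<le> v" for t
      using mono01[of t v] o that by auto
    have sub: "{0..v} \<subseteq> {0..1}" using o by auto
    have cFv: "continuous_on {0..v} F" and cfv: "continuous_on {0..v} f"
      using cF cf sub continuous_on_subset by blast+
    have cg: "continuous_on {0..v} g" and cg': "continuous_on {0..v} g'"
      unfolding g_def g'_def using lt1 by (fastforce intro!: continuous_intros cFv cfv)+
    have dF': "(F has_real_derivative f t) (at t)" and df': "(f has_real_derivative f' t) (at t)"
      if "0 < t" "t < v" for t
      using dF[of t] f'[of t] at[of t] that o by auto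
    have dg: "(g has_real_derivative g' t) (at t)" if "0 < t" "t < v" for t
      unfolding g_def g'_def using lt1[of t] that
      by (auto intro!: derivative_eq_intros dF'[OF that] simp: power2_eq_square)
    have dg': "\<exists>d. (g' has_real_derivative d) (at t) \<and> 0 \<le> d" if "0 < t" "t < v" for t
    proof -
      have p: "0 < 1 - F t" using lt1[of t] that by auto
      have "(g' has_real_derivative (f' t * (1 - F t) + 2 * (f t)\<^sup>2) / (1 - F t) ^ 3) (at t)"
      proof -
        define p where "p = 1 - F t"
        have "((\<lambda>t. (1 - F t)\<^sup>2) has_real_derivative - (2 * p * f t)) (at t)"
          by (auto intro!: derivative_eq_intros dF'[OF that] simp: p_def)
        from DERIV_divide[OF df'[OF that] this]
        have "(g' has_real_derivative (f' t * p\<^sup>2 - f t * - (2 * p * f t)) / (p\<^sup>2 * p\<^sup>2)) (at t)"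
          using p by (simp add: g'_def[abs_def] p_def)
        moreover have "(f' t * p\<^sup>2 - f t * - (2 * p * f t)) / (p\<^sup>2 * p\<^sup>2)
            = (f' t * p + 2 * (f t)\<^sup>2) / p ^ 3"
          using p unfolding p_def[symmetric]
          by (simp add: divide_simps) (simp add: power2_eq_square power3_eq_cube power4_eq_xxxx algebra_simps)
        ultimately show ?thesis by (simp add: p_def)
      qed
      moreover have "0 \<le> (f' t * (1 - F t) + 2 * (f t)\<^sup>2) / (1 - F t) ^ 3"
        using p reg[of t] that o by auto
      ultimately show ?thesis by blast
    qed
    have mvt: "\<exists>t. p < t \<and> t < q \<and> (g q - g p) / (q - p) = g' t" if "0 \<le> p" "p < q" "q \<le> v" for p q
    proof -
      have "continuous_on {p..q} g"
        by (rule continuous_on_subset[OF cg]) (use that in auto)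
      moreover have "(g has_derivative (\<lambda>h. g' t * h)) (at t)" if "p < t" "t < q" for t
        using dg[of t] that \<open>0 \<le> p\<close> \<open>q \<le> v\<close> by (simp add: has_field_derivative_def)
      ultimately obtain t where "p < t" "t < q" "g q - g p = g' t * (q - p)"
        using mvt[OF \<open>p < q\<close>, of g "\<lambda>t h. g' t * h"] by metis
      thus ?thesis using that by (auto simp: field_simps)
    qed
    obtain s where s: "x < s" "s < y" "(g y - g x) / (y - x) = g' s" using mvt[of x y] o by auto
    obtain t where t: "u < t" "t < v" "(g v - g u) / (v - u) = g' t" using mvt[of u v] o by auto
    have "g' s \<le> g' t"
    proof (rule DERIV_nonneg_imp_increasing_open[of s t g'])
      show "s \<le> t" using s t o by auto
      show "\<exists>d. (g' has_real_derivative d) (at r) \<and> 0 \<le> d" if "s < r" "r < t" for r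
        using dg'[of r] that s t o by auto
      show "continuous_on {s..t} g'"
        by (rule continuous_on_subset[OF cg']) (use s t o in auto)
    qed
    thus ?thesis using s t by (simp add: g_def)
  qed
  ultimately show ?thesis using F0 F1 by unfold_locales auto
qed

section \<open>Harmonic means, counting by potentials, and near-concavity of
  \<open>1 - F\<close>\<close>

text \<open>The arithmetic mean exceeds the harmonic one by exactly
  \<open>t * (1 - t) * (X - Z)^2 / d\<close>, where \<open>t * (1 - t) \<le> 1 / 4\<close> and
  \<open>Z \<le> d\<close>.\<close>

lemma weighted_harmonic_mean_ge:
  fixes X Z t :: real
  assumes "0 < Z" "Z \<le> X" "0 \<le> t" "t \<le> 1"
  shows "(1 - t) * X + t * Z - (X - Z)\<^sup>2 / (4 * Z) \<le> 1 / ((1 - t) / X + t / Z)"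
proof -
  define d where "d = (1 - t) * Z + t * X"
  have "d = Z + t * (X - Z)" by (simp add: d_def algebra_simps)
  hence dZ: "Z \<le> d" using assms by simp
  have t: "t * (1 - t) \<le> 1 / 4"
    using zero_le_power2[of "t - 1/2"] by (simp add: power2_eq_square algebra_simps)
  have "t * (1 - t) * (X - Z)\<^sup>2 / d \<le> (1 / 4) * (X - Z)\<^sup>2 / Z"
    using assms dZ t by (intro frac_le mult_right_mono) auto
  moreover have "1 / ((1 - t) / X + t / Z) = X * Z / d"
    using assms dZ by (simp add: d_def field_simps)
  moreover have "(1 - t) * X + t * Z = X * Z / d + t * (1 - t) * (X - Z)\<^sup>2 / d"
  proof -
    have "((1 - t) * X + t * Z) * d = X * Z + t * (1 - t) * (X - Z)\<^sup>2"
      by (simp add: d_def power2_eq_square algebra_simps)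
    thus ?thesis using assms(1) dZ by (simp add: add_divide_distrib[symmetric] eq_divide_eq)
  qed
  ultimately show ?thesis by simp
qed

text \<open>The values of \<Phi> are spaced by at least \<open>c\<close> within a range of length
  \<open>T\<close>; the \<open>+ 1\<close> arises because n points leave n - 1 gaps.\<close>

lemma card_le_potential:
  fixes \<Phi> :: "nat \<Rightarrow> real"
  assumes "finite I" "0 < c"
    and rng: "\<And>i. i \<in> I \<Longrightarrow> \<Phi> i \<in> {a..a + T}"
    and step: "\<And>i j. \<lbrakk>i \<in> I; j \<in> I; i < j\<rbrakk> \<Longrightarrow> \<Phi> i + c \<le> \<Phi> j"
    and "0 \<le> T"
  shows "real (card I) \<le> T / c + 1"
proof -
  \<comment> \<open>Indices are added in increasing order, so \<open>step\<close> applies between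
    the old maximiser of \<Phi> and the new index.\<close>
  have bound: "real (card K) * c \<le> Max (\<Phi> ` K) - a + c" if "finite K" "K \<noteq> {}" "K \<subseteq> I" for K
    using that
  proof (induction K rule: finite_linorder_max_induct)
    case empty
    thus ?case by simp
  next
    case (insert b K)
    show ?case
    proof (cases "K = {}")
      case True
      thus ?thesis using rng[of b] insert.prems by simp
    next
      case False
      have "Max (\<Phi> ` K) \<in> \<Phi> ` K" using False insert by (intro Max_in) auto
      then obtain k where k: "k \<in> K" "Max (\<Phi> ` K) = \<Phi> k" by auto
      have "\<Phi> k + c \<le> \<Phi> b" using k insert by (intro step) auto
      moreover have "\<Phi> b \<le> Max (\<Phi> ` insert b K)" using insert.hyps by (intro Max_ge) auto
      moreover have "real (card (insert b K)) * c = real (card K) * c + c"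
        using insert.hyps by (subst card_insert_disjoint) (auto simp: algebra_simps)
      moreover have "real (card K) * c \<le> Max (\<Phi> ` K) - a + c" using insert False by simp
      ultimately show ?thesis using k(2) by linarith
    qed
  qed
  have upper: "Max (\<Phi> ` I) \<le> a + T" if "I \<noteq> {}"
    using that assms(1) rng by (subst Max_le_iff) auto
  have "real (card I) * c \<le> T + c"
  proof (cases "I = {}")
    case False
    hence "real (card I) * c \<le> Max (\<Phi> ` I) - a + c" "Max (\<Phi> ` I) \<le> a + T"
      using bound[of I] upper assms(1) by blast+
    thus ?thesis by linarith
  qed (use assms(2) \<open>0 \<le> T\<close> in simp)
  thus ?thesis using \<open>0 < c\<close> by (simp add: field_simps)
qed

context regular_cdf
begin

lemma F_mono: "x \<le> y \<Longrightarrow> F x \<le> F y"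
  using mono_F by (simp add: monoD)

lemma F_bounds: "0 \<le> F x" "F x \<le> 1"
  using F_mono[of "min x 0" x] F_mono[of x "max x 1"] below[of "min x 0"] above[of "max x 1"] by auto

text \<open>Convexity of \<open>1 / (1 - F)\<close> bounds \<open>1 - F y\<close> below by a
  weighted harmonic mean of the end values; passing to the arithmetic mean costs the quadratic
  term.\<close>

lemma approx_concave:
  assumes "0 \<le> x" "x < y" "y < z" "z \<le> 1" "F z < 1"
  shows "((z - y) * (1 - F x) + (y - x) * (1 - F z)) / (z - x) - (F z - F x)\<^sup>2 / (4 * (1 - F z))
    \<le> 1 - F y"
proof -
  define t where "t = (y - x) / (z - x)"
  have t: "0 \<le> t" "t \<le> 1" using assms by (auto simp: t_def)
  have t1: "1 - t = (z - y) / (z - x)" using assms by (simp add: t_def field_simps)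
  have Fxz: "F x \<le> F z" "F y \<le> F z" using assms F_mono by auto
  have pos: "0 < 1 - F x" "0 < 1 - F y" "0 < 1 - F z" using assms Fxz by auto
  define X Y Z where XYZ: "X = 1 / (1 - F x)" "Y = 1 / (1 - F y)" "Z = 1 / (1 - F z)"
  have "(Y - X) / (y - x) \<le> (Z - Y) / (z - y)"
    using chord_slopes_mono[of x y y z] assms by (simp add: XYZ)
  hence "(Y - X) * (z - y) \<le> (Z - Y) * (y - x)" using assms by (simp add: field_simps)
  hence "Y * (z - x) \<le> (z - y) * X + (y - x) * Z" by (simp add: algebra_simps)
  hence Y: "Y \<le> (1 - t) * X + t * Z"
  proof -
    have "Y \<le> ((z - y) * X + (y - x) * Z) / (z - x)"
      using \<open>Y * (z - x) \<le> _\<close> assms by (subst pos_le_divide_eq) auto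
    thus ?thesis unfolding t1 by (simp add: t_def add_divide_distrib)
  qed
  have Yp: "0 < Y" using pos by (simp add: XYZ)
  have "1 / ((1 - t) * X + t * Z) \<le> 1 / Y" using Y Yp by (intro divide_left_mono) auto
  also have "1 / Y = 1 - F y" by (simp add: XYZ)
  finally have "1 / ((1 - t) / (1 - F x) + t / (1 - F z)) \<le> 1 - F y" by (simp add: XYZ)
  moreover have "(1 - t) * (1 - F x) + t * (1 - F z) - ((1 - F x) - (1 - F z))\<^sup>2 / (4 * (1 - F z))
     \<le> 1 / ((1 - t) / (1 - F x) + t / (1 - F z))"
    by (rule weighted_harmonic_mean_ge) (use pos t Fxz in auto)
  moreover have "(1 - t) * (1 - F x) + t * (1 - F z) = ((z - y) * (1 - F x) + (y - x) * (1 - F z)) / (z - x)"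
    unfolding t1 by (simp add: t_def add_divide_distrib)
  ultimately show ?thesis by simp
qed

end

section \<open>Split test and accuracy of linear interpolation\<close>

definition linear_interp :: "real \<Rightarrow> real \<Rightarrow> real \<Rightarrow> real \<Rightarrow> real \<Rightarrow> real" where
  "linear_interp l w y\<^sub>1 y\<^sub>3 x = y\<^sub>1 + (y\<^sub>3 - y\<^sub>1) * ((x - l) / w)"

text \<open>The second difference of the samples carries noise at most
  \<open>4 * \<epsilon>\<close>, so a value above \<open>9 * \<epsilon>\<close> certifies a true one
  of at least \<open>5 * \<epsilon>\<close>. The factor 64 makes a passed drop test limit the drop
  to a quarter of \<open>1 - y\<^sub>1\<close>.\<close>

definition fails :: "real \<Rightarrow> real \<Rightarrow> real \<Rightarrow> real \<Rightarrow> real \<Rightarrow> bool" where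
  "fails \<epsilon> w y\<^sub>1 y\<^sub>2 y\<^sub>3 \<longleftrightarrow> \<epsilon> < w \<and> 64 * \<epsilon> < 1 - y\<^sub>1 \<and>
     (4 * \<epsilon> * (1 - y\<^sub>1) < (y\<^sub>3 - y\<^sub>1)\<^sup>2 \<or> 9 * \<epsilon> < y\<^sub>1 + y\<^sub>3 - 2 * y\<^sub>2)"

lemma convex_comb_ge:
  fixes a b t :: real
  assumes "0 \<le> t" "t \<le> 1" "c \<le> a" "c \<le> b"
  shows "c \<le> a + (b - a) * t"
proof -
  have "(1 - t) * c + t * c \<le> (1 - t) * a + t * b"
    using assms by (intro add_mono mult_left_mono) auto
  thus ?thesis by (simp add: algebra_simps)
qed

lemma convex_comb_le:
  fixes a b t :: real
  assumes "0 \<le> t" "t \<le> 1" "a \<le> c" "b \<le> c"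
  shows "a + (b - a) * t \<le> c"
  using convex_comb_ge[of t "- c" "- a" "- b"] assms by (simp add: algebra_simps)

text \<open>The outer queries are shifted inwards by \<open>\<epsilon>\<^sup>2 / 2\<close>, so that the points \<open>p\<close>, \<open>r\<close> actually
  sampled stay inside the interval and samples of different intervals remain ordered.\<close>

locale interval_samples = regular_cdf +
  fixes \<epsilon> l w p q r y\<^sub>1 y\<^sub>2 y\<^sub>3 :: real
  assumes \<epsilon>: "0 < \<epsilon>" "\<epsilon> \<le> 1 / 100"
    and w: "0 < w" "0 \<le> l" "l + w \<le> 1"
    and p: "l \<le> p" "p \<le> l + \<epsilon>\<^sup>2"
    and q: "\<bar>q - (l + w / 2)\<bar> \<le> \<epsilon>\<^sup>2 / 2"
    and r: "l + w - \<epsilon>\<^sup>2 \<le> r" "r \<le> l + w"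
    and y: "\<bar>y\<^sub>1 - F p\<bar> \<le> \<epsilon>" "\<bar>y\<^sub>2 - F q\<bar> \<le> \<epsilon>" "\<bar>y\<^sub>3 - F r\<bar> \<le> \<epsilon>"
begin

lemma eps_sq: "\<epsilon>\<^sup>2 \<le> \<epsilon> / 100"
  using mult_left_mono[OF \<epsilon>(2), of \<epsilon>] \<epsilon> by (simp add: power2_eq_square)

lemma eps_sq_le:
  assumes "\<epsilon> < w"
  shows "\<epsilon>\<^sup>2 \<le> w / 100" "\<epsilon>\<^sup>2 \<le> \<epsilon> * w"
  using eps_sq assms \<epsilon> by (linarith, simp add: power2_eq_square)

lemma q_bounds: "l + w / 2 - \<epsilon>\<^sup>2 / 2 \<le> q" "q \<le> l + w / 2 + \<epsilon>\<^sup>2 / 2"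
  using q by linarith+

lemma y_bounds:
  "y\<^sub>1 \<le> F p + \<epsilon>" "F p - \<epsilon> \<le> y\<^sub>1" "y\<^sub>2 \<le> F q + \<epsilon>" "F q - \<epsilon> \<le> y\<^sub>2"
  "y\<^sub>3 \<le> F r + \<epsilon>" "F r - \<epsilon> \<le> y\<^sub>3"
  using y by (auto simp: abs_le_iff)

lemma sample_order:
  assumes "\<epsilon> < w"
  shows "0 \<le> p" "p < q" "q < r" "r \<le> 1"
  using eps_sq_le(1)[OF assms] w p q_bounds r by linarith+

lemma sample_increments:
  assumes "\<epsilon> < w"
  shows "48/100 * w \<le> q - p" "48/100 * w \<le> r - q" "98/100 * w \<le> r - p"
    and "q - p \<le> 51/100 * w" "r - q \<le> 51/100 * w" "r - p \<le> w"
  using eps_sq_le(1)[OF assms] w p q_bounds r by linarith+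

text \<open>For \<open>a = 1 - y\<^sub>1\<close> above \<open>64 * \<epsilon>\<close> one has
  \<open>4 * \<epsilon> * a \<le> (a / 4)^2\<close>, so the sampled drop is at most
  \<open>a / 4\<close>. The remaining slack absorbs the noise of the samples.\<close>

lemma small_drop:
  assumes "64 * \<epsilon> < 1 - y\<^sub>1" "(y\<^sub>3 - y\<^sub>1)\<^sup>2 \<le> 4 * \<epsilon> * (1 - y\<^sub>1)" "F p \<le> F r"
  shows "1 - F p \<le> 2 * (1 - F r)" "(F r - F p)\<^sup>2 \<le> 9 * \<epsilon> * (1 - F p)" "63 * \<epsilon> \<le> 1 - F p"
proof -
  define a where "a = 1 - y\<^sub>1"
  have a: "64 * \<epsilon> < a" using assms by (simp add: a_def)
  have "4 * \<epsilon> * a \<le> a / 16 * a" using a \<epsilon> by (intro mult_right_mono) auto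
  hence "(y\<^sub>3 - y\<^sub>1)\<^sup>2 \<le> (a / 4)\<^sup>2" using assms(2) by (simp add: a_def[symmetric] power2_eq_square)
  hence d: "y\<^sub>3 - y\<^sub>1 \<le> a / 4" by (rule power2_le_imp_le) (use a \<epsilon> in simp)
  show "1 - F p \<le> 2 * (1 - F r)" using d a y_bounds unfolding a_def by (simp add: field_simps)
  show "63 * \<epsilon> \<le> 1 - F p" using a y_bounds unfolding a_def by (simp add: field_simps)
  have "(F r - F p)\<^sup>2 \<le> (\<bar>y\<^sub>3 - y\<^sub>1\<bar> + 2 * \<epsilon>)\<^sup>2"
    using y assms(3) by (intro power_mono) (auto simp: abs_le_iff)
  also have "\<dots> \<le> 2 * (y\<^sub>3 - y\<^sub>1)\<^sup>2 + 8 * \<epsilon>\<^sup>2"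
    using zero_le_power2[of "\<bar>y\<^sub>3 - y\<^sub>1\<bar> - 2 * \<epsilon>"] by (simp add: power2_eq_square algebra_simps)
  also have "\<dots> \<le> 8 * \<epsilon> * a + 8 * \<epsilon> * \<epsilon>"
    using assms(2) by (simp add: a_def power2_eq_square)
  also have "\<dots> = 8 * \<epsilon> * (a + \<epsilon>)" by (simp add: algebra_simps)
  also have "\<dots> \<le> 8 * \<epsilon> * (9 / 8 * (1 - F p))"
    using a y \<epsilon> by (intro mult_left_mono) (auto simp: a_def abs_le_iff)
  finally show "(F r - F p)\<^sup>2 \<le> 9 * \<epsilon> * (1 - F p)" by (simp add: algebra_simps)
qed

text \<open>The two lines differ by the sample noise, at most \<epsilon> as a convex combination,
  and by the mismatch of the parameters \<mu> and \<tau>, at most \<open>3 * \<epsilon>\<close>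
  because \<open>\<epsilon>\<^sup>2 \<le> \<epsilon> * w\<close>.\<close>

lemma interp_near_chord:
  assumes "\<epsilon> < w" "p \<le> z" "z \<le> r"
  shows "\<bar>linear_interp l w y\<^sub>1 y\<^sub>3 z - (F p + (F r - F p) * ((z - p) / (r - p)))\<bar> \<le> 4 * \<epsilon>"
proof -
  define \<mu> \<tau> where "\<mu> = (z - l) / w" and "\<tau> = (z - p) / (r - p)"
  have \<mu>: "0 \<le> \<mu>" "\<mu> \<le> 1" using assms w p r by (auto simp: \<mu>_def)
  have pr: "98/100 * w \<le> r - p" using sample_increments[OF assms(1)] by simp
  have "\<mu> * w = z - l" using w by (simp add: \<mu>_def)
  hence "\<tau> - \<mu> = (\<mu> * (w - (r - p)) - (p - l)) / (r - p)"
    using pr w by (simp add: \<tau>_def field_simps)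
  moreover have "\<bar>\<mu> * (w - (r - p)) - (p - l)\<bar> \<le> 2 * \<epsilon>\<^sup>2"
  proof -
    have "0 \<le> \<mu> * (w - (r - p))" using \<mu> sample_increments[OF assms(1)] by simp
    moreover have "\<mu> * (w - (r - p)) \<le> 1 * (2 * \<epsilon>\<^sup>2)"
      using \<mu> sample_increments[OF assms(1)] p r by (intro mult_mono) auto
    ultimately show ?thesis using p by (auto simp: abs_le_iff)
  qed
  ultimately have "\<bar>\<tau> - \<mu>\<bar> \<le> (2 * \<epsilon>\<^sup>2) / (r - p)"
    using pr w by (simp add: abs_divide divide_right_mono)
  also have "\<dots> \<le> (2 * (\<epsilon> * w)) / (98/100 * w)"
    using eps_sq_le[OF assms(1)] pr w \<epsilon> by (intro frac_le) auto
  also have "\<dots> \<le> 3 * \<epsilon>" using w \<epsilon> by simp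
  finally have \<tau>\<mu>: "\<bar>\<tau> - \<mu>\<bar> \<le> 3 * \<epsilon>" .
  have "F p \<le> F r" using F_mono assms by auto
  hence "\<bar>F r - F p\<bar> \<le> 1" using F_bounds[of p] F_bounds[of r] by auto
  hence "\<bar>(F r - F p) * (\<tau> - \<mu>)\<bar> \<le> 1 * (3 * \<epsilon>)"
    unfolding abs_mult using \<tau>\<mu> by (intro mult_mono) auto
  moreover have "- \<epsilon> \<le> (y\<^sub>1 - F p) + ((y\<^sub>3 - F r) - (y\<^sub>1 - F p)) * \<mu>"
    "(y\<^sub>1 - F p) + ((y\<^sub>3 - F r) - (y\<^sub>1 - F p)) * \<mu> \<le> \<epsilon>"
    using y by (auto intro!: convex_comb_ge[OF \<mu>] convex_comb_le[OF \<mu>] simp: abs_le_iff)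
  moreover have "linear_interp l w y\<^sub>1 y\<^sub>3 z - (F p + (F r - F p) * \<tau>)
     = (y\<^sub>1 - F p) + ((y\<^sub>3 - F r) - (y\<^sub>1 - F p)) * \<mu> - (F r - F p) * (\<tau> - \<mu>)"
    by (simp add: linear_interp_def \<mu>_def[symmetric] algebra_simps)
  ultimately show ?thesis unfolding \<tau>_def[symmetric] by linarith
qed

text \<open>If \<open>1 - y\<^sub>1\<close> is small, both functions lie within
  \<open>66 * \<epsilon>\<close> of 1. Otherwise the deviation \<open>D\<close> of
  \<open>1 - F\<close> from its chord is nearly concave and zero at \<open>p\<close> and
  \<open>r\<close>, which bounds it below; the midpoint test controls it at \<open>q\<close>, which
  bounds it above.\<close>

lemma interp_accurate:
  assumes "\<not> fails \<epsilon> w y\<^sub>1 y\<^sub>2 y\<^sub>3" "\<epsilon> < w" "p \<le> z" "z \<le> r"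
  shows "\<bar>linear_interp l w y\<^sub>1 y\<^sub>3 z - F z\<bar> \<le> 70 * \<epsilon>"
proof (cases "1 - y\<^sub>1 \<le> 64 * \<epsilon>")
  case True
  have Fs: "F p \<le> F z" "F p \<le> F r" using F_mono assms by auto
  have z: "0 \<le> (z - l) / w" "(z - l) / w \<le> 1" using assms w p r by auto
  have "1 - 66 * \<epsilon> \<le> linear_interp l w y\<^sub>1 y\<^sub>3 z" "linear_interp l w y\<^sub>1 y\<^sub>3 z \<le> 1 + \<epsilon>"
    unfolding linear_interp_def
    by (rule convex_comb_ge[OF z] convex_comb_le[OF z];
        use True y Fs F_bounds(2)[of p] F_bounds(2)[of r] in linarith)+
  thus ?thesis using True y Fs F_bounds(2)[of z] \<epsilon> by (auto simp: abs_le_iff)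
next
  case False
  hence drop: "64 * \<epsilon> < 1 - y\<^sub>1" "(y\<^sub>3 - y\<^sub>1)\<^sup>2 \<le> 4 * \<epsilon> * (1 - y\<^sub>1)"
    and mid: "y\<^sub>1 + y\<^sub>3 - 2 * y\<^sub>2 \<le> 9 * \<epsilon>"
    using assms(1,2) unfolding fails_def by auto
  have pr: "p < r" "0 < r - p" using sample_order[OF assms(2)] by auto
  have "F p \<le> F r" using pr F_mono by auto
  note sd = small_drop[OF drop this]
  define ch where "ch z = 1 - (F p + (F r - F p) * ((z - p) / (r - p)))" for z
  define D where "D z = 1 - F z - ch z" for z
  have D0: "D p = 0" "D r = 0" using pr by (auto simp: D_def ch_def)
  \<comment> \<open>The error term of \<open>approx_concave\<close> is at most
    \<open>9 / 2 * \<epsilon>\<close>, because \<open>small_drop\<close> keeps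
    \<open>1 - F z\<close> above half of \<open>1 - F p\<close>.\<close>
  have conc: "((z - y) * D x + (y - x) * D z) / (z - x) - 5 * \<epsilon> \<le> D y"
    if xyz: "p \<le> x" "x < y" "y < z" "z \<le> r" for x y z
  proof -
    have Fs: "F z \<le> F r" "F p \<le> F x" "F x \<le> F z" using xyz F_mono by auto
    have "(F z - F x)\<^sup>2 / (4 * (1 - F z)) \<le> (9 * \<epsilon> * (1 - F p)) / (4 * ((1 - F p) / 2))"
    proof (rule frac_le)
      have "(F z - F x)\<^sup>2 \<le> (F r - F p)\<^sup>2" using Fs by (intro power_mono) auto
      thus "(F z - F x)\<^sup>2 \<le> 9 * \<epsilon> * (1 - F p)" using sd by simp
    qed (use sd Fs \<epsilon> in auto)
    also have "\<dots> = 9 / 2 * \<epsilon>" using sd(3) \<epsilon> by (simp add: divide_simps)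
    also have "\<dots> \<le> 5 * \<epsilon>" using \<epsilon> by simp
    finally have "(F z - F x)\<^sup>2 / (4 * (1 - F z)) \<le> 5 * \<epsilon>" .
    moreover have "((z - y) * (1 - F x) + (y - x) * (1 - F z)) / (z - x)
        - (F z - F x)\<^sup>2 / (4 * (1 - F z)) \<le> 1 - F y"
      using xyz sample_order[OF assms(2)] Fs sd \<epsilon> by (intro approx_concave) auto
    moreover have "((z - y) * D x + (y - x) * D z) / (z - x)
       = ((z - y) * (1 - F x) + (y - x) * (1 - F z)) / (z - x) - ch y"
    proof -
      \<comment> \<open>\<open>ch\<close> is affine, so subtracting it does not affect
        near-concavity.\<close>
      have "ch t = ch 0 + (ch 1 - ch 0) * t" for t
        using pr by (simp add: ch_def diff_divide_distrib algebra_simps)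
      then obtain \<alpha> \<beta> where ch: "\<And>t. ch t = \<alpha> + \<beta> * t" by blast
      have "(z - y) * ch x + (y - x) * ch z = ch y * (z - x)"
        by (simp add: ch algebra_simps)
      hence "ch y = ((z - y) * ch x + (y - x) * ch z) / (z - x)" using xyz by simp
      thus ?thesis by (simp add: D_def diff_divide_distrib[symmetric] algebra_simps)
    qed
    ultimately show ?thesis by (simp add: D_def)
  qed
  \<comment> \<open>In units of \<epsilon>: 4 from \<open>interp_near_chord\<close>, 1 because
    \<open>q\<close> may miss the midpoint, 9/2 from the midpoint test and 1 from the noise in
    \<open>y\<^sub>2\<close>.\<close>
  have Dq: "D q \<le> 11 * \<epsilon>"
  proof -
    have "\<bar>linear_interp l w y\<^sub>1 y\<^sub>3 q - (1 - ch q)\<bar> \<le> 4 * \<epsilon>"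
      using interp_near_chord[OF assms(2), of q] sample_order[OF assms(2)] by (simp add: ch_def)
    moreover have "linear_interp l w y\<^sub>1 y\<^sub>3 q = (y\<^sub>1 + y\<^sub>3) / 2 + (y\<^sub>3 - y\<^sub>1) * ((q - (l + w / 2)) / w)"
      using w by (simp add: linear_interp_def field_simps)
    moreover have "\<bar>(y\<^sub>3 - y\<^sub>1) * ((q - (l + w / 2)) / w)\<bar> \<le> 2 * (\<epsilon> / 2)"
    proof -
      have "\<bar>(q - (l + w / 2)) / w\<bar> \<le> (\<epsilon> * w / 2) / w"
        unfolding abs_divide using q w \<epsilon> eps_sq_le(2)[OF assms(2)]
        by (intro frac_le) auto
      hence "\<bar>(q - (l + w / 2)) / w\<bar> \<le> \<epsilon> / 2" using w by simp
      moreover have "\<bar>y\<^sub>3 - y\<^sub>1\<bar> \<le> 2"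
        using y F_bounds[of p] F_bounds[of r] \<epsilon> by (auto simp: abs_le_iff)
      ultimately show ?thesis unfolding abs_mult by (intro mult_mono) auto
    qed
    ultimately have "linear_interp l w y\<^sub>1 y\<^sub>3 q \<le> (y\<^sub>1 + y\<^sub>3) / 2 + \<epsilon>"
      "1 - ch q - 4 * \<epsilon> \<le> linear_interp l w y\<^sub>1 y\<^sub>3 q"
      by linarith+
    thus ?thesis using mid y_bounds(3,4) \<epsilon> unfolding D_def by (simp add: field_simps)
  qed
  have low: "- (5 * \<epsilon>) \<le> D z"
  proof (cases "z = p \<or> z = r")
    case False
    thus ?thesis using conc[of p z r] assms D0 by auto
  qed (use D0 \<epsilon> in auto)
  have up: "D z \<le> 48 * \<epsilon>"
  proof (cases "0 < D z")
    case pos: True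
    note inc = sample_increments[OF assms(2)]
    \<comment> \<open>Near-concavity from \<open>z\<close> through \<open>q\<close> to the far end,
      where \<open>D\<close> vanishes, makes \<open>D q\<close> at least a third of
      \<open>D z\<close> minus \<open>5 * \<epsilon>\<close>; a third suffices since
      \<open>q\<close> is close to the middle.\<close>
    consider "z < q" | "z = q" | "q < z" by linarith
    hence "D z \<le> 3 * (D q + 5 * \<epsilon>)"
    proof cases
      case 1
      have "(1 / 3) * D z \<le> ((r - q) / (r - z)) * D z"
        using pos 1 inc assms p sample_order[OF assms(2)] by (intro mult_right_mono) (auto simp: field_simps)
      moreover have "(r - q) / (r - z) * D z - 5 * \<epsilon> \<le> D q"
        using conc[of z q r] 1 assms D0 sample_order[OF assms(2)] by simp
      ultimately show ?thesis by argo
    next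
      case 3
      have "(1 / 3) * D z \<le> ((q - p) / (z - p)) * D z"
        using pos 3 inc assms p sample_order[OF assms(2)] by (intro mult_right_mono) (auto simp: field_simps)
      moreover have "(q - p) / (z - p) * D z - 5 * \<epsilon> \<le> D q"
        using conc[of p q z] 3 assms D0 sample_order[OF assms(2)] by simp
      ultimately show ?thesis by argo
    qed (use pos \<epsilon> in auto)
    thus ?thesis using Dq by simp
  qed (use \<epsilon> in auto)
  have "\<bar>linear_interp l w y\<^sub>1 y\<^sub>3 z - (1 - ch z)\<bar> \<le> 4 * \<epsilon>"
    using interp_near_chord[OF assms(2-4)] by (simp add: ch_def)
  thus ?thesis using low up \<epsilon> unfolding D_def by (simp add: abs_le_iff)
qed

text \<open>In a wide interval \<open>x\<close> is clamped to the range from \<open>p\<close> to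
  \<open>r\<close>, which moves the interpolant by at most \<open>2 * \<epsilon>\<close>. An
  interval no wider than \<epsilon> is absorbed by the horizontal slack of the Levy
  distance.\<close>

lemma interp_levy_close:
  assumes "\<not> fails \<epsilon> w y\<^sub>1 y\<^sub>2 y\<^sub>3" "l \<le> x" "x \<le> l + w"
  shows "F (x - 100 * \<epsilon>) - 100 * \<epsilon> \<le> linear_interp l w y\<^sub>1 y\<^sub>3 x"
    and "linear_interp l w y\<^sub>1 y\<^sub>3 x \<le> F (x + 100 * \<epsilon>) + 100 * \<epsilon>"
proof -
  have "F (x - 100 * \<epsilon>) - 100 * \<epsilon> \<le> linear_interp l w y\<^sub>1 y\<^sub>3 x \<and>
    linear_interp l w y\<^sub>1 y\<^sub>3 x \<le> F (x + 100 * \<epsilon>) + 100 * \<epsilon>"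
  proof (cases "\<epsilon> < w")
    case True
    define z where "z = max p (min r x)"
    have z: "p \<le> z" "z \<le> r" "\<bar>x - z\<bar> \<le> \<epsilon>\<^sup>2"
      using sample_order[OF True] assms p r by (auto simp: z_def max_def min_def)
    have "\<bar>(y\<^sub>3 - y\<^sub>1) * ((x - z) / w)\<bar> \<le> 2 * \<epsilon>"
    proof -
      have "\<bar>(x - z) / w\<bar> \<le> (\<epsilon> * w) / w"
        unfolding abs_divide using z w \<epsilon> eps_sq_le(2)[OF True] by (intro frac_le) auto
      hence "\<bar>(x - z) / w\<bar> \<le> \<epsilon>" using w by simp
      moreover have "\<bar>y\<^sub>3 - y\<^sub>1\<bar> \<le> 2"
        using y F_bounds[of p] F_bounds[of r] \<epsilon> by (auto simp: abs_le_iff)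
      ultimately show ?thesis unfolding abs_mult by (intro mult_mono) auto
    qed
    moreover have "linear_interp l w y\<^sub>1 y\<^sub>3 x
        = linear_interp l w y\<^sub>1 y\<^sub>3 z + (y\<^sub>3 - y\<^sub>1) * ((x - z) / w)"
      by (simp add: linear_interp_def diff_divide_distrib algebra_simps)
    moreover have "\<bar>linear_interp l w y\<^sub>1 y\<^sub>3 z - F z\<bar> \<le> 70 * \<epsilon>"
      by (rule interp_accurate) (use assms True z in auto)
    moreover have "F (x - 100 * \<epsilon>) \<le> F z" "F z \<le> F (x + 100 * \<epsilon>)"
      by (rule F_mono; use z eps_sq \<epsilon> in linarith)+
    ultimately show ?thesis using \<epsilon> by (intro conjI; linarith)
  next
    case False
    have t: "0 \<le> (x - l) / w" "(x - l) / w \<le> 1" using assms w by auto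
    have "F (x - 100 * \<epsilon>) \<le> F p" "F (x - 100 * \<epsilon>) \<le> F r"
      "F p \<le> F (x + 100 * \<epsilon>)" "F r \<le> F (x + 100 * \<epsilon>)"
      by (rule F_mono; use assms p r eps_sq \<epsilon> False in linarith)+
    thus ?thesis unfolding linear_interp_def
      using y \<epsilon> by (intro conjI convex_comb_ge[OF t] convex_comb_le[OF t]) (auto simp: abs_le_iff)
  qed
  thus "F (x - 100 * \<epsilon>) - 100 * \<epsilon> \<le> linear_interp l w y\<^sub>1 y\<^sub>3 x"
    "linear_interp l w y\<^sub>1 y\<^sub>3 x \<le> F (x + 100 * \<epsilon>) + 100 * \<epsilon>" by auto
qed

end

section \<open>Counting the intervals that are split\<close>

context regular_cdf
begin

definition recip_slope :: "real \<Rightarrow> real \<Rightarrow> real" where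
  "recip_slope x y = (1 / (1 - F y) - 1 / (1 - F x)) / (y - x)"

lemma recip_slope_eq:
  assumes "F x < 1" "F y < 1" "x < y"
  shows "recip_slope x y = (F y - F x) / ((1 - F x) * (1 - F y) * (y - x))"
  unfolding recip_slope_def using assms by (simp add: divide_simps)

end

context interval_samples
begin

text \<open>If the square roots were closer, factoring \<open>A - B\<close> would give
  \<open>(A - B)^2 \<le> \<epsilon> * A\<close>, whereas the drop test forces the strict
  opposite.\<close>

lemma fails_drop:
  assumes "64 * \<epsilon> < 1 - y\<^sub>1" "4 * \<epsilon> * (1 - y\<^sub>1) < (y\<^sub>3 - y\<^sub>1)\<^sup>2" "F p \<le> F r"
  shows "sqrt (1 - F r) + sqrt \<epsilon> / 2 \<le> sqrt (1 - F p)"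
proof (rule ccontr)
  define A B where "A = 1 - F p" and "B = 1 - F r"
  assume "\<not> ?thesis"
  hence less: "sqrt A - sqrt B \<le> sqrt \<epsilon> / 2" by (simp add: A_def B_def)
  have AB: "0 \<le> B" "B \<le> A" using F_bounds assms(3) by (auto simp: A_def B_def)
  have a: "A \<le> 65 / 64 * (1 - y\<^sub>1)" using assms(1) y by (auto simp: A_def abs_le_iff)
  \<comment> \<open>The sampled drop exceeds \<open>16 * \<epsilon>\<close>, so the noise
    \<open>2 * \<epsilon>\<close> is at most an eighth of it; this leaves the factor 7/8.\<close>
  have "(16 * \<epsilon>)\<^sup>2 \<le> 4 * \<epsilon> * (1 - y\<^sub>1)"
    using assms(1) \<epsilon> by (simp add: power2_eq_square)
  hence "(16 * \<epsilon>)\<^sup>2 < (y\<^sub>3 - y\<^sub>1)\<^sup>2" using assms(2) by linarith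
  hence "16 * \<epsilon> < \<bar>y\<^sub>3 - y\<^sub>1\<bar>" using \<epsilon> by (metis abs_of_pos abs_less_iff power2_abs power2_less_imp_less abs_ge_zero)
  hence d: "16 * \<epsilon> < y\<^sub>3 - y\<^sub>1" using y_bounds assms(3) \<epsilon> by linarith
  hence "7 / 8 * (y\<^sub>3 - y\<^sub>1) \<le> A - B" using y_bounds(2,5) unfolding A_def B_def by (simp add: field_simps)
  hence "(7 / 8 * (y\<^sub>3 - y\<^sub>1))\<^sup>2 \<le> (A - B)\<^sup>2" using d \<epsilon> by (intro power_mono) auto
  hence "49 / 64 * (4 * \<epsilon> * (1 - y\<^sub>1)) < (A - B)\<^sup>2" using assms(2)
    unfolding power_mult_distrib by (simp add: power_divide)
  moreover have "\<epsilon> * A \<le> \<epsilon> * (65 / 64 * (1 - y\<^sub>1))" using a \<epsilon> by (intro mult_left_mono) auto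
  moreover have "0 \<le> \<epsilon> * (1 - y\<^sub>1)" using assms(1) \<epsilon> by simp
  ultimately have big: "\<epsilon> * A < (A - B)\<^sup>2" by argo
  have "A - B = (sqrt A - sqrt B) * (sqrt A + sqrt B)"
    using AB by (simp add: algebra_simps)
  also have "\<dots> \<le> (sqrt \<epsilon> / 2) * (2 * sqrt A)"
    using less AB \<epsilon> by (intro mult_mono) auto
  finally have "(A - B)\<^sup>2 \<le> (sqrt \<epsilon> * sqrt A)\<^sup>2" using AB by (intro power_mono) auto
  also have "\<dots> = \<epsilon> * A" using AB \<epsilon> by (simp add: power_mult_distrib)
  finally show False using big by simp
qed

text \<open>A bent midpoint makes the increment \<open>E\<close> of \<open>F\<close> after
  \<open>q\<close> exceed the increment \<open>D\<close> before it, over nearly equal widths. The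
  assumption \<open>short\<close> turns this absolute gain into a relative one for
  \<open>1 +\<close> slope; the summand 1 keeps the logarithm nonnegative when the slope is near
  0.\<close>

lemma fails_slope:
  assumes "\<epsilon> < w" "64 * \<epsilon> < 1 - y\<^sub>1" "(y\<^sub>3 - y\<^sub>1)\<^sup>2 \<le> 4 * \<epsilon> * (1 - y\<^sub>1)"
    and mid: "9 * \<epsilon> < y\<^sub>1 + y\<^sub>3 - 2 * y\<^sub>2"
    and short: "w + F r - F p \<le> sqrt \<epsilon>"
  shows "F r < 1" "0 \<le> recip_slope p q" "1 + recip_slope p q \<le> 1 / \<epsilon> ^ 3"
    and "(1 + recip_slope p q) * (1 + sqrt \<epsilon>) \<le> 1 + recip_slope q r"
proof -
  note ord = sample_order[OF assms(1)] and inc = sample_increments[OF assms(1)]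
  have Fs: "F p \<le> F q" "F q \<le> F r" "F p \<le> F r" using ord F_mono by auto
  note sd = small_drop[OF assms(2,3) Fs(3)]
  define A M B where AMB: "A = 1 - F p" "M = 1 - F q" "B = 1 - F r"
  have AMB_le: "63 * \<epsilon> \<le> A" "A \<le> 2 * B" "B \<le> M" "M \<le> A" "A \<le> 1"
    using sd Fs F_bounds by (auto simp: AMB)
  have pos: "0 < A" "0 < M" "0 < B" using AMB_le \<epsilon> by auto
  define u v where uv: "u = q - p" "v = r - q"
  have uvp: "0 < u" "0 < v" using ord by (auto simp: uv)
  define D E where DE: "D = F q - F p" "E = F r - F q"
  have DEn: "0 \<le> D" "0 \<le> E" "D + E \<le> 1" using Fs F_bounds(1)[of p] F_bounds(2)[of r] by (auto simp: DE)
  have gap: "5 * \<epsilon> \<le> E - D" using mid y unfolding DE by (auto simp: abs_le_iff)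
  show "F r < 1" using pos by (simp add: AMB)
  have \<sigma>1: "recip_slope p q = D / (A * M * u)"
    using pos ord by (subst recip_slope_eq) (auto simp: AMB DE uv)
  have \<sigma>2: "recip_slope q r = E / (M * B * v)"
    using pos ord by (subst recip_slope_eq) (auto simp: AMB DE uv)
  show \<sigma>1n: "0 \<le> recip_slope p q" using DEn pos uvp by (simp add: \<sigma>1)
  \<comment> \<open>The factor \<open>31 * \<epsilon>\<close> comes from
    \<open>M \<ge> B \<ge> A / 2\<close>; the width \<open>u\<close> is close to half of
    \<open>w > \<epsilon>\<close>.\<close>
  have "D / (A * M * u) \<le> 1 / ((63 * \<epsilon>) * (31 * \<epsilon>) * (\<epsilon> / 3))"
    using DEn AMB_le \<epsilon> pos uvp inc assms(1) by (intro frac_le mult_mono mult_pos_pos) (auto simp: uv)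
  also have "\<dots> = 1 / 651 * (1 / \<epsilon> ^ 3)" using \<epsilon> by (simp add: power3_eq_cube)
  finally have "recip_slope p q \<le> 1 / 651 * (1 / \<epsilon> ^ 3)" by (simp add: \<sigma>1)
  moreover have "\<epsilon> ^ 3 \<le> (1 / 100) ^ 3" using \<epsilon> by (intro power_mono) auto
  hence "2 \<le> 1 / \<epsilon> ^ 3" using \<epsilon> by (simp add: field_simps power3_eq_cube)
  ultimately show "1 + recip_slope p q \<le> 1 / \<epsilon> ^ 3" by linarith
  have dev: "\<bar>u - w / 2\<bar> \<le> 3 / 2 * \<epsilon>\<^sup>2" "\<bar>v - w / 2\<bar> \<le> 3 / 2 * \<epsilon>\<^sup>2"
    using p q_bounds r unfolding uv by linarith+
  \<comment> \<open>The main term \<open>(E - D) * (w / 2)\<close> is at least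
    \<open>5 / 2 * \<epsilon> * w\<close>; the deviations of \<open>u\<close> and \<open>v\<close>
    from \<open>w / 2\<close> cost at most \<open>3 / 2 * \<epsilon> * w\<close>.\<close>
  have "\<epsilon> * w \<le> E * u - D * v"
  proof -
    have "\<bar>E * (u - w / 2)\<bar> \<le> E * (3 / 2 * \<epsilon>\<^sup>2)" "\<bar>D * (v - w / 2)\<bar> \<le> D * (3 / 2 * \<epsilon>\<^sup>2)"
      unfolding abs_mult using dev DEn by (simp_all only: abs_of_nonneg mult_left_mono)
    moreover have "(D + E) * (3 / 2 * \<epsilon>\<^sup>2) \<le> 1 * (3 / 2 * (\<epsilon> * w))"
      using DEn eps_sq_le(2)[OF assms(1)] by (intro mult_mono) auto
    moreover have "5 * \<epsilon> * (w / 2) \<le> (E - D) * (w / 2)"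
      using gap w by (intro mult_right_mono) auto
    moreover have "E * u - D * v = (E - D) * (w / 2) + E * (u - w / 2) - D * (v - w / 2)"
      by (simp add: field_simps)
    ultimately show ?thesis by (simp add: distrib_right)
  qed
  \<comment> \<open>Here \<open>short\<close> enters, as
    \<open>u + D \<le> sqrt \<epsilon>\<close>.\<close>
  moreover have "sqrt \<epsilon> * (A * M * u * v + D * v) \<le> \<epsilon> * w"
  proof -
    have "A * M * u * v \<le> 1 * u * v"
      using AMB_le pos uvp by (intro mult_right_mono mult_le_one) auto
    hence "A * M * u * v + D * v \<le> v * (u + D)" by (simp add: algebra_simps)
    also have "\<dots> \<le> w * sqrt \<epsilon>"
      using inc short Fs DEn uvp w unfolding uv[symmetric]
      by (intro mult_mono) (auto simp: DE)
    finally have "sqrt \<epsilon> * (A * M * u * v + D * v) \<le> sqrt \<epsilon> * (w * sqrt \<epsilon>)"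
      using \<epsilon> by (intro mult_left_mono) auto
    also have "\<dots> = \<epsilon> * w" using \<epsilon> by simp
    finally show ?thesis .
  qed
  ultimately have "sqrt \<epsilon> * (A * M * u * v + D * v) \<le> E * u - D * v" by linarith
  hence "sqrt \<epsilon> * (A * M * u * v + D * v) / (A * M * u * v) \<le> (E * u - D * v) / (A * M * u * v)"
    using pos uvp by (intro divide_right_mono) auto
  moreover have "sqrt \<epsilon> * (A * M * u * v + D * v) / (A * M * u * v) = sqrt \<epsilon> * (1 + D / (A * M * u))"
    using pos uvp by (simp add: add_divide_distrib distrib_left)
  moreover have "(E * u - D * v) / (A * M * u * v) = E / (A * M * v) - D / (A * M * u)"
    using pos uvp by (simp add: diff_divide_distrib)
  \<comment> \<open>Replacing \<open>B\<close> by the larger \<open>A\<close> only lowers the second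
    slope and gives both slopes the factor \<open>A * M\<close>.\<close>
  moreover have "E / (A * M * v) \<le> E / (M * B * v)"
    using DEn pos uvp AMB_le by (intro divide_left_mono) (auto simp: mult.commute[of A])
  ultimately have "sqrt \<epsilon> * (1 + D / (A * M * u)) + D / (A * M * u) \<le> E / (M * B * v)"
    by linarith
  thus "(1 + recip_slope p q) * (1 + sqrt \<epsilon>) \<le> 1 + recip_slope q r"
    unfolding \<sigma>1 \<sigma>2 by (simp only: distrib_left distrib_right mult_1 mult_1_right mult.commute[of _ "sqrt \<epsilon>"])
qed

end

text \<open>Quantifying over all admissible samples makes failure independent of the adversary, so
  one count covers all answers.\<close>

definition fails_at :: "(real \<Rightarrow> real) \<Rightarrow> real \<Rightarrow> real \<Rightarrow> nat \<Rightarrow> bool" where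
  "fails_at F \<epsilon> w i \<longleftrightarrow> (\<exists>p q r y\<^sub>1 y\<^sub>2 y\<^sub>3.
     interval_samples F \<epsilon> (real i * w) w p q r y\<^sub>1 y\<^sub>2 y\<^sub>3 \<and> fails \<epsilon> w y\<^sub>1 y\<^sub>2 y\<^sub>3)"

text \<open>Large drops go to \<open>I1\<close>, intervals where \<open>x + F x\<close> grows by
  more than about \<open>sqrt \<epsilon>\<close> to \<open>I2\<close>, and the remaining bent ones
  to \<open>I3\<close>; each class has its own potential.\<close>

lemma card_fails_at_le:
  assumes fin: "finite I" and fails: "\<And>i. i \<in> I \<Longrightarrow> fails_at F \<epsilon> w i"
    and \<epsilon>: "0 < \<epsilon>" "\<epsilon> \<le> 1 / 100"
  shows "real (card I) \<le> 7 * (1 + ln (1 / \<epsilon>)) / sqrt \<epsilon>"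
proof (cases "I = {}")
  case True
  thus ?thesis using \<epsilon> by simp
next
  case False
  have "\<forall>i\<in>I. \<exists>p q r. \<exists>y\<^sub>1 y\<^sub>2 y\<^sub>3.
     interval_samples F \<epsilon> (real i * w) w p q r y\<^sub>1 y\<^sub>2 y\<^sub>3 \<and> fails \<epsilon> w y\<^sub>1 y\<^sub>2 y\<^sub>3"
    using fails unfolding fails_at_def by blast
  then obtain p q r y\<^sub>1 y\<^sub>2 y\<^sub>3 where
    smp: "\<And>i. i \<in> I \<Longrightarrow> interval_samples F \<epsilon> (real i * w) w (p i) (q i) (r i) (y\<^sub>1 i) (y\<^sub>2 i) (y\<^sub>3 i)"
    and fl: "\<And>i. i \<in> I \<Longrightarrow> fails \<epsilon> w (y\<^sub>1 i) (y\<^sub>2 i) (y\<^sub>3 i)"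
    by metis
  have ew: "\<epsilon> < w" using False fl by (auto simp: fails_def)
  interpret regular_cdf F
    using False smp by (auto simp: interval_samples_def)
  note ord = interval_samples.sample_order[OF smp ew]
  have Fs: "F (p i) \<le> F (q i)" "F (q i) \<le> F (r i)" "F (p i) \<le> F (r i)" if "i \<in> I" for i
    using ord[OF that] F_mono by auto
  have sep: "r i \<le> p j" "real i * w + w \<le> real j * w" if "i \<in> I" "j \<in> I" "i < j" for i j
  proof -
    have "(real i + 1) * w \<le> real j * w" using that ew \<epsilon> by (intro mult_right_mono) auto
    thus 1: "real i * w + w \<le> real j * w" by (simp add: algebra_simps)
    show "r i \<le> p j"
      using interval_samples.r(2)[OF smp[OF that(1)]] interval_samples.p(1)[OF smp[OF that(2)]] 1
      by simp
  qed
  define s where "s = sqrt \<epsilon>"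
  have "sqrt \<epsilon> \<le> sqrt ((1 / 10)\<^sup>2)"
    using \<epsilon> by (intro real_sqrt_le_mono) (simp add: power2_eq_square)
  hence s: "0 < s" "s \<le> 1 / 10" using \<epsilon> by (auto simp: s_def)
  define L where "L = ln (1 / \<epsilon>)"
  have L: "0 \<le> L" using \<epsilon> by (simp add: L_def)
  define I1 where "I1 = {i \<in> I. 4 * \<epsilon> * (1 - y\<^sub>1 i) < (y\<^sub>3 i - y\<^sub>1 i)\<^sup>2}"
  define I2 where "I2 = {i \<in> I. s < w + F (r i) - F (p i)}"
  define I3 where "I3 = I - I1 - I2"
  have "real (card I1) \<le> 1 / (s / 2) + 1"
  proof (rule card_le_potential[where \<Phi> = "\<lambda>i. - sqrt (1 - F (p i))" and a = "-1"])
    fix i j assume ij: "i \<in> I1" "j \<in> I1" "i < j"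
    have "sqrt (1 - F (r i)) + s / 2 \<le> sqrt (1 - F (p i))"
      unfolding s_def using interval_samples.fails_drop[OF smp] ij fl[of i] Fs[of i]
      by (auto simp: I1_def fails_def)
    moreover have "sqrt (1 - F (p j)) \<le> sqrt (1 - F (r i))"
      using sep(1)[of i j] ij by (auto simp: I1_def intro!: F_mono)
    ultimately show "- sqrt (1 - F (p i)) + s / 2 \<le> - sqrt (1 - F (p j))" by linarith
  qed (use fin F_bounds s in \<open>auto simp: I1_def\<close>)
  moreover have "real (card I2) \<le> 2 / s + 1"
  proof (rule card_le_potential[where \<Phi> = "\<lambda>i. real i * w + F (p i)" and a = 0])
    fix i assume i: "i \<in> I2"
    hence "0 \<le> real i * w" "real i * w + w \<le> 1"
      using interval_samples.w[OF smp] by (auto simp: I2_def)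
    thus "real i * w + F (p i) \<in> {0..0 + 2}" using F_bounds[of "p i"] ew \<epsilon> by auto
  next
    fix i j assume ij: "i \<in> I2" "j \<in> I2" "i < j"
    hence "F (r i) \<le> F (p j)" using sep(1)[of i j] by (auto simp: I2_def intro!: F_mono)
    thus "real i * w + F (p i) + s \<le> real j * w + F (p j)"
      using sep(2)[of i j] ij by (auto simp: I2_def)
  qed (use fin s in \<open>auto simp: I2_def\<close>)
  moreover have "real (card I3) \<le> (3 * L) / (s / 2) + 1"
  proof (rule card_le_potential[where \<Phi> = "\<lambda>i. ln (1 + recip_slope (p i) (q i))" and a = 0])
    have slope: "F (r i) < 1" "0 \<le> recip_slope (p i) (q i)"
        "1 + recip_slope (p i) (q i) \<le> 1 / \<epsilon> ^ 3"
        "(1 + recip_slope (p i) (q i)) * (1 + s) \<le> 1 + recip_slope (q i) (r i)"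
      if "i \<in> I3" for i
      unfolding s_def using interval_samples.fails_slope[OF smp ew] that fl[of i]
      by (auto simp: I3_def I1_def I2_def fails_def s_def not_less)
    show "ln (1 + recip_slope (p i) (q i)) \<in> {0..0 + 3 * L}" if "i \<in> I3" for i
    proof -
      have "ln (1 + recip_slope (p i) (q i)) \<le> ln (1 / \<epsilon> ^ 3)"
        using slope[OF that] \<epsilon> by (subst ln_le_cancel_iff) auto
      also have "\<dots> = 3 * L" using \<epsilon> by (simp add: L_def ln_div ln_realpow)
      finally show ?thesis using slope(2)[OF that] by simp
    qed
    show "ln (1 + recip_slope (p i) (q i)) + s / 2 \<le> ln (1 + recip_slope (p j) (q j))"
      if ij: "i \<in> I3" "j \<in> I3" "i < j" for i j
    proof -
      have I: "i \<in> I" "j \<in> I" using ij by (auto simp: I3_def)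
      have "F (q j) < 1" using Fs(2)[OF I(2)] slope(1)[OF ij(2)] by simp
      \<comment> \<open>Convexity carries the gain made inside interval \<open>i\<close> over to the
        later interval \<open>j\<close>.\<close>
      hence "recip_slope (q i) (r i) \<le> recip_slope (p j) (q j)"
        unfolding recip_slope_def using ord[OF I(1)] ord[OF I(2)] sep(1)[OF I ij(3)]
        by (intro chord_slopes_mono) auto
      hence "(1 + recip_slope (p i) (q i)) * (1 + s) \<le> 1 + recip_slope (p j) (q j)"
        using slope(4)[OF ij(1)] by simp
      hence "ln ((1 + recip_slope (p i) (q i)) * (1 + s)) \<le> ln (1 + recip_slope (p j) (q j))"
        using slope(2)[OF ij(1)] slope(2)[OF ij(2)] s by (subst ln_le_cancel_iff) auto
      moreover have "ln ((1 + recip_slope (p i) (q i)) * (1 + s))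
          = ln (1 + recip_slope (p i) (q i)) + ln (1 + s)"
        using slope(2)[OF ij(1)] s by (intro ln_mult_pos) auto
      moreover have "s * s \<le> s * (1 / 2)" using s by (intro mult_left_mono) auto
      hence "s / 2 \<le> ln (1 + s)"
        using ln_one_plus_pos_lower_bound[of s] s unfolding power2_eq_square by linarith
      ultimately show ?thesis by linarith
    qed
  qed (use fin s L in \<open>auto simp: I3_def\<close>)
  moreover have "card I \<le> card I1 + card I2 + card I3"
  proof -
    have "I = I1 \<union> I2 \<union> I3" by (auto simp: I1_def I2_def I3_def)
    thus ?thesis by (metis card_Un_le add_right_mono le_trans)
  qed
  ultimately have "real (card I) \<le> 4 / s + 6 * L / s + 3" by simp
  \<comment> \<open>The summand 3 is absorbed by \<open>3 / s\<close>, as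
    \<open>s \<le> 1 / 10\<close>.\<close>
  also have "\<dots> \<le> 7 * (1 + L) / s"
    using s L by (simp add: divide_simps)
  finally show ?thesis by (simp add: s_def L_def)
qed

section \<open>The bisection algorithm as a decision tree\<close>

definition levy_close :: "(real \<Rightarrow> real) \<Rightarrow> real \<Rightarrow> (real \<Rightarrow> real) \<Rightarrow> real \<Rightarrow> bool" where
  "levy_close F d g x \<longleftrightarrow> F (x - d) - d \<le> g x \<and> g x \<le> F (x + d) + d"

lemma learns_Output:
  assumes "\<And>x. levy_close F d g x" "0 \<le> d" "d \<le> d'"
  shows "learns F \<epsilon> d' n (Output g)"
proof (rule learns.out)
  have d: "d \<in> levy_set F g" using assms by (auto simp: levy_set_def levy_close_def)
  thus "levy_set F g \<noteq> {}" by auto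
  have "levy_dist F g \<le> d"
    unfolding levy_dist_def using d by (rule cInf_lower) (auto simp: levy_set_def intro: bdd_belowI)
  thus "levy_dist F g \<le> d'" using assms by simp
qed

lemma learns_mono: "learns F \<epsilon> d n A \<Longrightarrow> n \<le> n' \<Longrightarrow> learns F \<epsilon> d n' A"
proof (induction arbitrary: n' rule: learns.induct)
  case (out G n)
  thus ?case by (blast intro: learns.out)
next
  case (qry x n k)
  then obtain n'' where "n' = Suc n''" "n \<le> n''" by (cases n') auto
  thus ?case using qry.IH by (auto intro: learns.qry)
qed

text \<open>Which intervals fail is known only after the answers, so the rest of the algorithm is
  passed as a continuation \<open>k\<close>.\<close>

primrec sweep :: "real \<Rightarrow> real \<Rightarrow> nat list \<Rightarrow> nat list \<Rightarrow> (real \<Rightarrow> real)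
    \<Rightarrow> (nat list \<Rightarrow> (real \<Rightarrow> real) \<Rightarrow> qalg) \<Rightarrow> qalg" where
  "sweep \<epsilon> w [] fl g k = k fl g"
| "sweep \<epsilon> w (i # todo) fl g k =
    Query (real i * w + \<epsilon>\<^sup>2 / 2) (\<lambda>y\<^sub>1. Query (real i * w + w / 2) (\<lambda>y\<^sub>2.
    Query (real i * w + w - \<epsilon>\<^sup>2 / 2) (\<lambda>y\<^sub>3.
      if fails \<epsilon> w y\<^sub>1 y\<^sub>2 y\<^sub>3 then sweep \<epsilon> w todo (i # fl) g k
      else sweep \<epsilon> w todo fl (\<lambda>x. if real i * w \<le> x \<and> x \<le> real i * w + w
             then linear_interp (real i * w) w y\<^sub>1 y\<^sub>3 x else g x) k)))"

text \<open>The loop invariant; \<open>I\<close> holds the intervals still to be settled.\<close>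

definition covered :: "(real \<Rightarrow> real) \<Rightarrow> real \<Rightarrow> real \<Rightarrow> nat set \<Rightarrow> (real \<Rightarrow> real) \<Rightarrow> bool" where
  "covered F \<epsilon> w I g \<longleftrightarrow>
     (\<forall>x. levy_close F (100 * \<epsilon>) g x \<or> (\<exists>i\<in>I. real i * w \<le> x \<and> x \<le> real i * w + w))"

text \<open>Any valid answers to the three queries form an \<open>interval_samples\<close>. Hence a
  failing interval joins \<open>fl\<close> with evidence for \<open>fails_at\<close>, and on an
  accepted one \<open>interp_levy_close\<close> justifies patching \<open>g\<close>.\<close>

lemma learns_sweep:
  assumes F: "regular_cdf F" and \<epsilon>: "0 < \<epsilon>" "\<epsilon> \<le> 1 / 100" and "0 < w"
    and "distinct (todo @ fl)"
    and "\<And>i. i \<in> set todo \<Longrightarrow> real i * w + w \<le> 1"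
    and "\<And>i. i \<in> set fl \<Longrightarrow> fails_at F \<epsilon> w i"
    and "covered F \<epsilon> w (set todo \<union> set fl) g"
    and k: "\<And>fl g. \<lbrakk>distinct fl; \<And>i. i \<in> set fl \<Longrightarrow> fails_at F \<epsilon> w i; covered F \<epsilon> w (set fl) g\<rbrakk>
      \<Longrightarrow> learns F \<epsilon> d n (k fl g)"
  shows "learns F \<epsilon> d (n + 3 * length todo) (sweep \<epsilon> w todo fl g k)"
  using assms(5-8)
proof (induction todo arbitrary: fl g)
  case Nil
  thus ?case using k by simp
next
  case (Cons i todo)
  define l where "l = real i * w"
  have "learns F \<epsilon> d (n + 3 * length todo)
      (if fails \<epsilon> w y\<^sub>1 y\<^sub>2 y\<^sub>3 then sweep \<epsilon> w todo (i # fl) g k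
       else sweep \<epsilon> w todo fl (\<lambda>x. if l \<le> x \<and> x \<le> l + w
              then linear_interp l w y\<^sub>1 y\<^sub>3 x else g x) k)"
    if v: "valid_answer F \<epsilon> (l + \<epsilon>\<^sup>2 / 2) y\<^sub>1" "valid_answer F \<epsilon> (l + w / 2) y\<^sub>2"
       "valid_answer F \<epsilon> (l + w - \<epsilon>\<^sup>2 / 2) y\<^sub>3" for y\<^sub>1 y\<^sub>2 y\<^sub>3
  proof -
    from v obtain a b a' b' a'' b'' where ab:
      "\<bar>a\<bar> \<le> \<epsilon>\<^sup>2 / 2" "\<bar>b\<bar> \<le> \<epsilon>" "y\<^sub>1 = F (l + \<epsilon>\<^sup>2 / 2 + a) + b"
      "\<bar>a'\<bar> \<le> \<epsilon>\<^sup>2 / 2" "\<bar>b'\<bar> \<le> \<epsilon>" "y\<^sub>2 = F (l + w / 2 + a') + b'"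
      "\<bar>a''\<bar> \<le> \<epsilon>\<^sup>2 / 2" "\<bar>b''\<bar> \<le> \<epsilon>" "y\<^sub>3 = F (l + w - \<epsilon>\<^sup>2 / 2 + a'') + b''"
      unfolding valid_answer_def by blast
    have bnd: "a \<le> \<epsilon>\<^sup>2 / 2" "- (\<epsilon>\<^sup>2 / 2) \<le> a" "a'' \<le> \<epsilon>\<^sup>2 / 2" "- (\<epsilon>\<^sup>2 / 2) \<le> a''"
      using ab(1,7) by (simp_all only: abs_le_iff) linarith+
    interpret regular_cdf F by (rule F)
    interpret interval_samples F \<epsilon> l w "l + \<epsilon>\<^sup>2 / 2 + a" "l + w / 2 + a'" "l + w - \<epsilon>\<^sup>2 / 2 + a''" y\<^sub>1 y\<^sub>2 y\<^sub>3
    proof unfold_locales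
      show "0 \<le> l" "l + w \<le> 1" using Cons.prems(2)[of i] \<open>0 < w\<close> by (auto simp: l_def)
    qed (use bnd ab \<epsilon> \<open>0 < w\<close> in simp_all)
    show ?thesis
    proof (cases "fails \<epsilon> w y\<^sub>1 y\<^sub>2 y\<^sub>3")
      case True
      hence "fails_at F \<epsilon> w i"
        using interval_samples_axioms unfolding fails_at_def l_def by blast
      hence "learns F \<epsilon> d (n + 3 * length todo) (sweep \<epsilon> w todo (i # fl) g k)"
        using Cons.prems by (intro Cons.IH) (auto simp: Un_commute)
      thus ?thesis using True by simp
    next
      case False
      define g' where "g' x = (if l \<le> x \<and> x \<le> l + w then linear_interp l w y\<^sub>1 y\<^sub>3 x else g x)" for x
      have "covered F \<epsilon> w (set todo \<union> set fl) g'"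
        unfolding covered_def
      proof
        fix x
        show "levy_close F (100 * \<epsilon>) g' x \<or>
          (\<exists>i\<in>set todo \<union> set fl. real i * w \<le> x \<and> x \<le> real i * w + w)"
        proof (cases "l \<le> x \<and> x \<le> l + w")
          case True
          thus ?thesis using interp_levy_close[OF False, of x] by (simp add: levy_close_def g'_def)
        next
          case False
          moreover have "levy_close F (100 * \<epsilon>) g x \<or>
            (\<exists>i\<in>set (i # todo) \<union> set fl. real i * w \<le> x \<and> x \<le> real i * w + w)"
            using Cons.prems(4) unfolding covered_def by blast
          ultimately show ?thesis by (auto simp: levy_close_def g'_def l_def)
        qed
      qed
      hence "learns F \<epsilon> d (n + 3 * length todo) (sweep \<epsilon> w todo fl g' k)"
        using Cons.prems by (intro Cons.IH) auto
      thus ?thesis using False by (simp add: g'_def[abs_def])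
    qed
  qed
  moreover have "n + 3 * length (i # todo) = Suc (Suc (Suc (n + 3 * length todo)))" by simp
  ultimately show ?case unfolding l_def by (simp only: sweep.simps) (intro learns.qry)
qed

text \<open>The fuel \<open>m\<close> makes the recursion primitive; \<open>learns_bisect\<close>
  shows that nothing is pending when it runs out.\<close>

primrec bisect :: "real \<Rightarrow> nat \<Rightarrow> nat \<Rightarrow> nat list \<Rightarrow> (real \<Rightarrow> real) \<Rightarrow> qalg" where
  "bisect \<epsilon> 0 j todo g = Output g"
| "bisect \<epsilon> (Suc m) j todo g = sweep \<epsilon> (1 / 2 ^ j) todo [] g
     (\<lambda>fl g. bisect \<epsilon> m (Suc j) (map (\<lambda>i. 2 * i) fl @ map (\<lambda>i. 2 * i + 1) fl) g)"

lemma learns_bisect: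
  assumes F: "regular_cdf F" and \<epsilon>: "0 < \<epsilon>" "\<epsilon> \<le> 1 / 100"
    and B: "7 * (1 + ln (1 / \<epsilon>)) / sqrt \<epsilon> < real B + 1"
    and "2 / 2 ^ (j + m) \<le> \<epsilon>" and "todo \<noteq> [] \<Longrightarrow> \<epsilon> < 2 / 2 ^ j"
    and "distinct todo" and "\<And>i. i \<in> set todo \<Longrightarrow> real i * (1 / 2 ^ j) + 1 / 2 ^ j \<le> 1"
    and "length todo \<le> 2 * B" and "covered F \<epsilon> (1 / 2 ^ j) (set todo) g"
  shows "learns F \<epsilon> (100 * \<epsilon>) (m * (6 * B)) (bisect \<epsilon> m j todo g)"
  using assms(5-)
proof (induction m arbitrary: j todo g)
  case 0
  \<comment> \<open>With \<open>m = 0\<close> a pending interval would give both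
    \<open>\<epsilon> < 2 / 2 ^ j\<close> and \<open>2 / 2 ^ j \<le> \<epsilon>\<close>.\<close>
  hence "todo = []" by fastforce
  hence "levy_close F (100 * \<epsilon>) g x" for x using 0 by (simp add: covered_def)
  thus ?case using \<epsilon> by (intro learns_Output[where d = "100 * \<epsilon>"] | simp)+
next
  case (Suc m)
  define w :: real where "w = 1 / 2 ^ j"
  have w: "0 < w" by (simp add: w_def)
  have "learns F \<epsilon> (100 * \<epsilon>) (m * (6 * B) + 3 * length todo)
    (sweep \<epsilon> w todo [] g
     (\<lambda>fl g. bisect \<epsilon> m (Suc j) (map (\<lambda>i. 2 * i) fl @ map (\<lambda>i. 2 * i + 1) fl) g))"
  proof (rule learns_sweep[OF F \<epsilon> w])
    fix fl g
    assume fl: "distinct fl" "\<And>i. i \<in> set fl \<Longrightarrow> fails_at F \<epsilon> w i" "covered F \<epsilon> w (set fl) g"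
    have "real (card (set fl)) \<le> 7 * (1 + ln (1 / \<epsilon>)) / sqrt \<epsilon>"
      by (rule card_fails_at_le) (use fl \<epsilon> in auto)
    \<comment> \<open>The strict bound by \<open>real B + 1\<close> rounds down to
      \<open>B\<close>.\<close>
    hence len: "length fl \<le> B" using B fl(1) by (simp add: distinct_card)
    let ?ch = "map (\<lambda>i. 2 * i) fl @ map (\<lambda>i. 2 * i + 1) fl"
    show "learns F \<epsilon> (100 * \<epsilon>) (m * (6 * B)) (bisect \<epsilon> m (Suc j) ?ch g)"
    proof (rule Suc.IH)
      show "2 / 2 ^ (Suc j + m) \<le> \<epsilon>" using Suc.prems(1) by simp
      show "\<epsilon> < 2 / 2 ^ Suc j" if "?ch \<noteq> []"
      proof -
        obtain i where "i \<in> set fl" using \<open>?ch \<noteq> []\<close> by (cases fl) auto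
        thus ?thesis using fl(2) by (auto simp: fails_at_def fails_def w_def)
      qed
      show "distinct ?ch"
        using fl(1) by (auto simp: distinct_map inj_on_def) presburger
      show "length ?ch \<le> 2 * B" using len by simp
      have h: "1 / 2 ^ Suc j = w / 2" by (simp add: w_def)
      show "real i * (1 / 2 ^ Suc j) + 1 / 2 ^ Suc j \<le> 1" if i: "i \<in> set ?ch" for i
      proof -
        obtain i' where i': "i' \<in> set fl" "i = 2 * i' \<or> i = 2 * i' + 1"
          using i unfolding set_append set_map by blast
        have "real i' * w + w \<le> 1"
          using fl(2)[OF i'(1)] by (auto simp: fails_at_def interval_samples_def interval_samples_axioms_def)
        thus ?thesis unfolding h using i'(2) w by (auto simp: field_simps)
      qed
      show "covered F \<epsilon> (1 / 2 ^ Suc j) (set ?ch) g"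
        unfolding covered_def h
      proof
        fix x
        show "levy_close F (100 * \<epsilon>) g x \<or>
          (\<exists>i\<in>set ?ch. real i * (w / 2) \<le> x \<and> x \<le> real i * (w / 2) + w / 2)"
        proof (cases "levy_close F (100 * \<epsilon>) g x")
          case False
          then obtain i where i: "i \<in> set fl" "real i * w \<le> x" "x \<le> real i * w + w"
            using fl(3) unfolding covered_def by blast
          have "\<exists>i\<in>set ?ch. real i * (w / 2) \<le> x \<and> x \<le> real i * (w / 2) + w / 2"
          proof (cases "x \<le> real i * w + w / 2")
            case True
            thus ?thesis using i by (intro bexI[of _ "2 * i"]) auto
          next
            case False
            thus ?thesis using i by (intro bexI[of _ "2 * i + 1"]) (auto simp: algebra_simps)
          qed
          thus ?thesis ..
        qed simp
      qed
    qed
  qed (use Suc.prems in \<open>auto simp: w_def\<close>)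
  hence "learns F \<epsilon> (100 * \<epsilon>) (m * (6 * B) + 3 * length todo) (bisect \<epsilon> (Suc m) j todo g)"
    by (simp add: w_def)
  moreover have "m * (6 * B) + 3 * length todo \<le> Suc m * (6 * B)" using Suc.prems(5) by simp
  ultimately show ?case by (rule learns_mono)
qed

section \<open>The final query bound\<close>

theorem theorem8:
  shows "\<exists>C K. 0 < C \<and> 0 < K \<and>
    (\<forall>\<epsilon>::real. 0 < \<epsilon> \<and> \<epsilon> < 1 \<longrightarrow>
      (\<exists>A n. real n \<le> K * \<epsilon> powr (-1/2) * (1 + ln (1/\<epsilon>)) powr K \<and>
         (\<forall>F. smooth_regular_01 F \<longrightarrow> learns F \<epsilon> (C * \<epsilon>) n A)))"
\<comment> \<open>84 is 6 * 2 * 7: \<open>6 * B\<close> queries on each of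
  \<open>m \<le> 2 * (1 + L)\<close> levels, with
  \<open>B \<le> 7 * (1 + L) / sqrt \<epsilon>\<close>.\<close>
proof (rule exI[of _ 100], rule exI[of _ 84], intro conjI allI impI)
  fix \<epsilon> :: real assume \<epsilon>: "0 < \<epsilon> \<and> \<epsilon> < 1"
  define L where "L = ln (1 / \<epsilon>)"
  have L: "0 \<le> L" using \<epsilon> by (simp add: L_def)
  show "\<exists>A n. real n \<le> 84 * \<epsilon> powr (-1/2) * (1 + ln (1/\<epsilon>)) powr 84 \<and>
         (\<forall>F. smooth_regular_01 F \<longrightarrow> learns F \<epsilon> (100 * \<epsilon>) n A)"
  proof (cases "\<epsilon> \<le> 1 / 100")
    case False
    \<comment> \<open>Here \<open>100 * \<epsilon>\<close> exceeds 1, and the zero function is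
      within Levy distance 1 of every CDF, so no query is made.\<close>
    have "learns F \<epsilon> (100 * \<epsilon>) 0 (Output (\<lambda>_. 0))" if "smooth_regular_01 F" for F
    proof (rule learns_Output[where d = 1])
      interpret regular_cdf F by (rule smooth_regular_01_imp_regular_cdf[OF that])
      show "levy_close F 1 (\<lambda>_. 0) x" for x
        using F_bounds[of "x - 1"] F_bounds[of "x + 1"] by (simp add: levy_close_def)
    qed (use False in auto)
    thus ?thesis by (intro exI[of _ "Output (\<lambda>_. 0)"] exI[of _ 0]) auto
  next
    case small: True
    define B where "B = nat \<lfloor>7 * (1 + L) / sqrt \<epsilon>\<rfloor>"
    \<comment> \<open>The 2 in \<open>2 / \<epsilon>\<close> yields the bound
      \<open>2 / 2 ^ m \<le> \<epsilon>\<close> that \<open>learns_bisect\<close> asks for at depth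
      0.\<close>
    define m where "m = nat \<lceil>log 2 (2 / \<epsilon>)\<rceil>"
    have s: "0 < sqrt \<epsilon>" "sqrt \<epsilon> \<le> 1" using \<epsilon> by auto
    have "0 \<le> 7 * (1 + L) / sqrt \<epsilon>" using L s by simp
    hence B: "real B \<le> 7 * (1 + L) / sqrt \<epsilon>" "7 * (1 + L) / sqrt \<epsilon> < real B + 1"
      unfolding B_def by linarith+
    have "1 \<le> 7 * (1 + L) / sqrt \<epsilon>" 
    proof -
      have "sqrt \<epsilon> \<le> 7 * (1 + L)" using s L by argo
      thus ?thesis using s by (simp only: le_divide_eq) simp
    qed
    hence B1: "1 \<le> B" using B by linarith
    have lg: "0 \<le> log 2 (2 / \<epsilon>)" using \<epsilon> by (simp add: zero_le_log_cancel_iff)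
    have m: "log 2 (2 / \<epsilon>) \<le> real m" "real m \<le> log 2 (2 / \<epsilon>) + 1"
      unfolding m_def using lg by linarith+
    have "2 / \<epsilon> = 2 powr (log 2 (2 / \<epsilon>))" using \<epsilon> by simp
    also have "\<dots> \<le> 2 powr (real m)" using m by (intro powr_mono) auto
    also have "\<dots> = 2 ^ m" by (simp add: powr_realpow)
    finally have m2: "2 / 2 ^ m \<le> \<epsilon>" using \<epsilon> by (simp add: field_simps)
    have ln2: "1 / 2 \<le> ln (2::real)" using ln2_ge_two_thirds by simp
    have "log 2 (2 / \<epsilon>) = 1 + L / ln 2"
      using \<epsilon> by (simp add: log_def L_def ln_div diff_divide_distrib)
    also have "L / ln 2 \<le> L / (1 / 2)" using L ln2 by (intro divide_left_mono) auto
    finally have m_le: "real m \<le> 2 * (1 + L)" using m by simp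
    have "real (m * (6 * B)) = 6 * (real m * real B)" by simp
    also have "\<dots> \<le> 6 * (2 * (1 + L) * (7 * (1 + L) / sqrt \<epsilon>))"
      using m_le B L s by (intro mult_left_mono mult_mono) auto
    also have "\<dots> = 84 * (1 / sqrt \<epsilon>) * (1 + L)\<^sup>2"
      using s by (simp add: power2_eq_square field_simps)
    also have "1 / sqrt \<epsilon> = \<epsilon> powr (-1/2)"
      using \<epsilon> by (simp add: powr_minus_divide powr_half_sqrt)
    \<comment> \<open>The exponent 2 is raised to 84 because a single \<open>K\<close> serves as
      factor and exponent.\<close>
    also have "84 * \<epsilon> powr (-1/2) * (1 + L)\<^sup>2 \<le> 84 * \<epsilon> powr (-1/2) * (1 + L) powr 84"
    proof (intro mult_left_mono)
      have "(1 + L)\<^sup>2 = (1 + L) powr 2" using L by simp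
      also have "\<dots> \<le> (1 + L) powr 84" using L by (intro powr_mono) auto
      finally show "(1 + L)\<^sup>2 \<le> (1 + L) powr 84" .
    qed auto
    finally have n: "real (m * (6 * B)) \<le> 84 * \<epsilon> powr (-1/2) * (1 + L) powr 84" .
    \<comment> \<open>This initial guess agrees with \<open>F\<close> outside the unit interval, so
      only the root interval is pending.\<close>
    define g\<^sub>0 :: "real \<Rightarrow> real" where "g\<^sub>0 x = (if x < 0 then 0 else 1)" for x
    have "learns F \<epsilon> (100 * \<epsilon>) (m * (6 * B)) (bisect \<epsilon> m 0 [0] g\<^sub>0)" if "smooth_regular_01 F" for F
    proof (rule learns_bisect)
      show F: "regular_cdf F" by (rule smooth_regular_01_imp_regular_cdf[OF that])
      then interpret regular_cdf F .
      show "covered F \<epsilon> (1 / 2 ^ 0) (set [0]) g\<^sub>0"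
        unfolding covered_def
      proof
        fix x :: real
        have "levy_close F (100 * \<epsilon>) g\<^sub>0 x" if "x < 0 \<or> 1 < x"
          using that \<epsilon> F_bounds[of "x + 100 * \<epsilon>"] F_bounds[of "x - 100 * \<epsilon>"]
            below[of "x - 100 * \<epsilon>"] above[of "x + 100 * \<epsilon>"]
          by (auto simp: levy_close_def g\<^sub>0_def)
        thus "levy_close F (100 * \<epsilon>) g\<^sub>0 x \<or>
          (\<exists>i\<in>set [0]. real i * (1 / 2 ^ 0) \<le> x \<and> x \<le> real i * (1 / 2 ^ 0) + 1 / 2 ^ 0)"
          by force
      qed
    qed (use \<epsilon> small B B1 m2 in \<open>auto simp: L_def\<close>)
    thus ?thesis using n unfolding L_def by blast
  qed
qed auto

end
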